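(* Let $n \ge 1$ and $t \ge 1$ be integers, and let $\alpha, \beta, \gamma \in \mathbb{F}_{3^n}^*$. Define $f: \mathbb{F}_{3^n} \to \mathbb{F}_{3^n}$ by $$f(x) = \begin{cases} 0 & \text{if } x = 0, \\ \alpha(x^3 + \gamma x^2 + \gamma^2 x) & \text{if } x \in C_0, \\ \beta x^t & \text{if } x \in C_1. \end{cases}$$ Suppose $f$ is a permutation of $\mathbb{F}_{3^n}$ and $\eta(\alpha) = (-1)^m$ with $m \in \{0,1\}$. Then the inverse of $f$ on $\mathbb{F}_{3^n}$ is $$f^{-1}(x) = -u(x)\left(1 + (-1)^m x^{(3^n-1)/2}\right) - v(x)\left(1 + (-1)^{m+1} x^{(3^n-1)/2}\right),$$ where: - $u(x) = \sum_{0 \le j,k \le n-1} \gamma \left(\alpha^{-1}\gamma^{-3} x\right)^{\frac{3^j+3^k}{2}}$; - $v(x) = (-1)^r (\beta^{-1} x)^s$, with $r, s$ integers such that $1 \le s < (3^n-1)/2$ and $st + r(3^n-1)/2 = 1$.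
   Context: $C_0 = \{e^2 : e \in \mathbb{F}_{3^n}^*\}$ and $C_1 = \mathbb{F}_{3^n}^* \setminus C_0$. $\eta$ is the quadratic character of $\mathbb{F}_{3^n}$: $\eta(a) = 1$ on $C_0$ and $-1$ on $C_1$. The inverse of $f$ is a polynomial $g$ with $g(f(c)) = c$ for all $c \in \mathbb{F}_{3^n}$. It is known that such $f$ is a permutation if and only if $\gcd(t, \frac{3^n-1}{2}) = 1$, $\eta(\gamma) = -1$ and $\eta(\alpha) = \eta(\beta)(-1)^{t+1}$. *)

theory Defs
  imports "HOL-Library.Cardinality" "HOL-Computational_Algebra.Polynomial"
begin

definition C0 :: "'a::{finite,field} set" where
  "C0 = {e ^ 2 | e. e \<noteq> 0}"

definition C1 :: "'a::{finite,field} set" where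
  "C1 = {a. a \<noteq> 0} - C0"

definition quad_char :: "'a::{finite,field} \<Rightarrow> int" where
  "quad_char a = (if a \<in> C0 then 1 else if a \<in> C1 then -1 else 0)"

definition f_map :: "'a::{finite,field} \<Rightarrow> 'a \<Rightarrow> 'a \<Rightarrow> nat \<Rightarrow> 'a \<Rightarrow> 'a" where
  "f_map \<alpha> \<beta> \<gamma> t x =
     (if x \<in> C0 then \<alpha> * (x ^ 3 + \<gamma> * x ^ 2 + \<gamma> ^ 2 * x)
      else if x \<in> C1 then \<beta> * x ^ t
      else 0)"

definition inverse_poly_of :: "'a::{finite,field} poly \<Rightarrow> ('a \<Rightarrow> 'a) \<Rightarrow> bool" where
  "inverse_poly_of g f \<longleftrightarrow> (\<forall>c. poly g (f c) = c)"

abbreviation X :: "'a::comm_semiring_1 poly" where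
  "X \<equiv> [:0, 1:]"

(* 3^j + 3^k is even, so the division by 2 in the exponent is exact. *)
definition u_poly :: "nat \<Rightarrow> 'a::{finite,field} \<Rightarrow> 'a \<Rightarrow> 'a poly" where
  "u_poly n \<alpha> \<gamma> =
     (\<Sum>j<n. \<Sum>k<n. smult \<gamma> (smult (inverse \<alpha> * inverse (\<gamma> ^ 3)) X ^ ((3 ^ j + 3 ^ k) div 2)))"

(* The integer r may be negative, hence powi. *)
definition v_poly :: "'a::{finite,field} \<Rightarrow> int \<Rightarrow> nat \<Rightarrow> 'a poly" where
  "v_poly \<beta> r s = smult ((-1) powi r) (smult (inverse \<beta>) X ^ s)"

definition f_inv_poly ::
  "nat \<Rightarrow> 'a::{finite,field} \<Rightarrow> 'a \<Rightarrow> 'a \<Rightarrow> nat \<Rightarrow> int \<Rightarrow> nat \<Rightarrow> 'a poly" where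
  "f_inv_poly n \<alpha> \<beta> \<gamma> m r s =
     - u_poly n \<alpha> \<gamma> * (1 + (-1) ^ m * X ^ ((3 ^ n - 1) div 2))
     - v_poly \<beta> r s * (1 + (-1) ^ (m + 1) * X ^ ((3 ^ n - 1) div 2))"

end

theory Submission
  imports Defs
begin

text \<open>
  Write \<open>q = 3 ^ n\<close> and \<open>N = (q - 1) / 2\<close>, so that \<open>x ^ N\<close> is the quadratic character of \<open>x\<close>.
  In characteristic 3 the first branch of \<open>f\<close> is \<open>\<alpha> c (c - \<gamma>)\<^sup>2\<close>. Injectivity at \<open>0\<close> therefore
  forces \<open>\<gamma>\<close> to be a nonsquare, and surjectivity at the value \<open>\<alpha> \<gamma>\<close> forces the values on \<open>C1\<close>
  to have the character opposite to that of \<open>\<alpha>\<close>; so exactly one of the two factors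
  \<open>1 \<plusminus> (-1) ^ m x ^ N\<close> vanishes at \<open>f c\<close>, and the other is \<open>2 = -1\<close>. On \<open>C1\<close> the
  Bezout relation gives \<open>v (f c) = c\<close>. On \<open>C0\<close>, with \<open>z = c / \<gamma>\<close>, the double sum in
  \<open>u (f c)\<close> is \<open>(\<Sum>j<n. d ^ 3 ^ j)\<^sup>2\<close> for \<open>d = \<surd>z ^ 3 - \<surd>z\<close>; the inner sum
  telescopes to \<open>\<surd>z ^ q - \<surd>z = \<surd>z\<close>. Factoring one \<open>\<surd>z\<close> out of each sum
  keeps the computation inside the field.
\<close>

text \<open>Multiplication by \<open>x\<close> permutes the nonzero elements, so their product
  absorbs a factor \<open>x\<close> for each of them.\<close>

lemma field_power_card_minus_one:
  fixes x :: "'a::{finite,field}"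
  assumes "x \<noteq> 0"
  shows "x ^ (CARD('a) - 1) = 1"
proof -
  have "\<Prod>(UNIV - {0}) = (\<Prod>y\<in>UNIV - {0}. x * y)"
    by (rule prod.reindex_bij_witness[of _ "\<lambda>y. x * y" "\<lambda>y. y / x"]) (use assms in auto)
  also have "\<dots> = x ^ (CARD('a) - 1) * \<Prod>(UNIV - {0})"
    by (simp add: prod.distrib card_Diff_singleton)
  finally show ?thesis by simp
qed

text \<open>Translation by 1 permutes the ring, so the sum of all elements does not change when 1 is
  added to each. This is how characteristic 3 is read off from the cardinality.\<close>

lemma of_nat_card_eq_0: "of_nat CARD('a) = (0 :: 'a::{finite,ring_1})"
proof -
  have "(\<Sum>x\<in>UNIV. x + 1) = (\<Sum>x\<in>UNIV. x :: 'a)"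
    by (rule sum.reindex_bij_witness[of _ "\<lambda>x. x - 1" "\<lambda>x. x + 1"]) auto
  thus ?thesis by (simp add: sum.distrib)
qed

lemma C0_power_half_card:
  fixes x :: "'a::{finite,field}"
  assumes "x \<in> C0" and "CARD('a) = 2 * N + 1"
  shows "x ^ N = 1"
  using assms field_power_card_minus_one[where 'a = 'a] by (auto simp: C0_def simp flip: power_mult)

text \<open>Squaring is at most two-to-one, and there are \<open>2 * N\<close> nonzero
  elements.\<close>

lemma card_C0_ge:
  assumes "CARD('a::{finite,field}) = 2 * N + 1"
  shows "N \<le> card (C0 :: 'a set)"
proof -
  have roots: "card {e. e ^ 2 = y} \<le> 2" for y :: 'a
  proof (cases "\<exists>d. d ^ 2 = y")
    case True
    then obtain d where "d ^ 2 = y" ..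
    hence "{e. e ^ 2 = y} \<subseteq> {d, - d}" by (auto simp: power2_eq_iff)
    hence "card {e. e ^ 2 = y} \<le> card {d, - d}" by (intro card_mono) auto
    also have "\<dots> \<le> 2" by (simp add: card_insert_if)
    finally show ?thesis .
  qed simp
  have "2 * N = card (UNIV - {0 :: 'a})"
    using assms by (simp add: card_Diff_singleton)
  also have "UNIV - {0 :: 'a} \<subseteq> (\<Union>y\<in>C0. {e. e ^ 2 = y})" by (auto simp: C0_def)
  hence "card (UNIV - {0 :: 'a}) \<le> card (\<Union>y\<in>(C0 :: 'a set). {e. e ^ 2 = y})"
    by (intro card_mono) auto
  also have "\<dots> \<le> (\<Sum>y\<in>(C0 :: 'a set). card {e. e ^ 2 = y})" by (intro card_UN_le) auto
  also have "\<dots> \<le> (\<Sum>y\<in>(C0 :: 'a set). 2)" by (intro sum_mono roots)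
  finally show ?thesis by simp
qed

text \<open>The squares are among the at most \<open>N\<close> roots of the polynomial
  \<open>p\<close>, and there are at least \<open>N\<close> of them, so they are all the
  roots.\<close>

lemma C0_iff_power_half_card:
  fixes x :: "'a::{finite,field}"
  assumes "CARD('a) = 2 * N + 1" and "N > 0"
  shows "x \<in> C0 \<longleftrightarrow> x ^ N = 1"
proof -
  define p where "p = monom (1 :: 'a) N - 1"
  have roots: "{x. x ^ N = 1} = {x. poly p x = 0}" by (simp add: p_def poly_monom)
  have deg: "degree p = N"
    using \<open>N > 0\<close> unfolding p_def
    by (subst diff_conv_add_uminus, subst degree_add_eq_left) (auto simp: degree_monom_eq)
  hence "p \<noteq> 0" using \<open>N > 0\<close> by auto
  hence "card {x :: 'a. x ^ N = 1} \<le> N"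
    unfolding roots using card_poly_roots_bound deg by metis
  moreover have "(C0 :: 'a set) \<subseteq> {x. x ^ N = 1}"
    using C0_power_half_card assms by blast
  ultimately have "(C0 :: 'a set) = {x. x ^ N = 1}"
    using card_C0_ge[OF assms(1)] by (intro card_seteq) auto
  thus ?thesis by blast
qed

lemma C1_power_half_card:
  fixes x :: "'a::{finite,field}"
  assumes "x \<in> C1" and "CARD('a) = 2 * N + 1" and "N > 0"
  shows "x ^ N = - 1"
proof -
  have "(x ^ N) ^ 2 = 1"
    using assms field_power_card_minus_one[of x]
    by (simp add: C1_def mult.commute flip: power_mult)
  moreover have "x ^ N \<noteq> 1"
    using assms C0_iff_power_half_card[of N x] by (simp add: C1_def)
  ultimately show ?thesis by (simp add: power2_eq_1_iff)
qed

lemma quad_char_power_half_card: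
  fixes x :: "'a::{finite,field}"
  assumes "CARD('a) = 2 * N + 1" and "N > 0"
  shows "of_int (quad_char x) = x ^ N"
  using assms C0_power_half_card[of x N] C1_power_half_card[of x N]
  by (auto simp: quad_char_def C1_def C0_def)

text \<open>The summand 1 on the right supplies the factor \<open>z\<close> that is pulled out of
  the double sum; it also shows that no exponent is 0.\<close>

lemma half_sum_powers_three:
  "(3 ^ j + 3 ^ k) div 2 = (3 ^ j - 1) div 2 + (3 ^ k - 1) div 2 + (1 :: nat)"
proof -
  have "odd (3 ^ i :: nat)" for i by simp
  then obtain a b where "(3 :: nat) ^ j = 2 * a + 1" "(3 :: nat) ^ k = 2 * b + 1"
    by (meson oddE)
  thus ?thesis by simp
qed

lemma half_power_three_Suc:
  "(3 ^ Suc j - 1) div 2 = (3 ^ j - 1) div 2 + (3 ^ j :: nat)"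
proof -
  have "odd (3 ^ j :: nat)" by simp
  then obtain a where "(3 :: nat) ^ j = 2 * a + 1" by (meson oddE)
  thus ?thesis by simp
qed

context
  fixes n :: nat
  assumes card: "CARD('a::{finite,field}) = 3 ^ n"
begin

lemma three_eq_0: "(3 :: 'a) = 0"
proof -
  have "(3 :: 'a) ^ n = of_nat CARD('a)" by (simp add: card)
  thus ?thesis by (simp add: of_nat_card_eq_0)
qed

lemma two_eq_minus_1: "(2 :: 'a) = - 1"
proof -
  have "(2 :: 'a) = 3 - 1" by simp
  thus ?thesis by (simp only: three_eq_0) simp
qed

lemma diff_one_cube_power: "(z - 1) ^ 3 ^ j = z ^ 3 ^ j - (1 :: 'a)"
proof (induction j)
  case (Suc j)
  have cube: "(w - 1) ^ 3 = w ^ 3 - 1" for w :: 'a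
  proof -
    have "(w - 1) ^ 3 = w ^ 3 - 1 + 3 * (w - w ^ 2)"
      by (simp add: power2_eq_square power3_eq_cube algebra_simps)
    thus ?thesis by (simp add: three_eq_0)
  qed
  have "(z - 1) ^ 3 ^ Suc j = ((z - 1) ^ 3 ^ j) ^ 3"
    by (simp add: mult.commute flip: power_mult)
  also have "\<dots> = z ^ 3 ^ Suc j - 1"
    by (simp add: Suc cube mult.commute flip: power_mult)
  finally show ?case .
qed simp

lemma double_sum_half_powers:
  fixes z :: 'a
  assumes "z ^ ((3 ^ n - 1) div 2) = - 1"
  shows "(\<Sum>j<n. \<Sum>k<n. (z * (z - 1) ^ 2) ^ ((3 ^ j + 3 ^ k) div 2)) = z"
proof -
  define a :: "nat \<Rightarrow> nat" where "a j = (3 ^ j - 1) div 2" for j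
  \<comment> \<open>With w a square root of \<open>z\<close> and d = w^3 - w, this is the sum of the
    d^(3^j) divided by w.\<close>
  define T where "T = (\<Sum>j<n. z ^ a j * (z - 1) ^ 3 ^ j)"
  have summand: "(z * (z - 1) ^ 2) ^ ((3 ^ j + 3 ^ k) div 2)
      = z * ((z ^ a j * (z - 1) ^ 3 ^ j) * (z ^ a k * (z - 1) ^ 3 ^ k))" for j k
  proof -
    have "2 * ((3 ^ j + 3 ^ k) div 2) = 3 ^ j + (3 ^ k :: nat)" by simp
    hence "(z * (z - 1) ^ 2) ^ ((3 ^ j + 3 ^ k) div 2)
        = z ^ ((3 ^ j + 3 ^ k) div 2) * (z - 1) ^ (3 ^ j + 3 ^ k)"
      by (simp only: power_mult_distrib flip: power_mult)
    also have "\<dots> = z ^ (a j + a k + 1) * (z - 1) ^ (3 ^ j + 3 ^ k)"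
      by (simp only: half_sum_powers_three a_def)
    finally show ?thesis by (simp add: power_add mult_ac)
  qed
  \<comment> \<open>Expanding \<open>(z - 1) ^ 3 ^ j\<close> by Frobenius, the product with
    \<open>z ^ a j\<close> splits since \<open>a (Suc j) = a j + 3 ^ j\<close>.\<close>
  have "T = (\<Sum>j<n. z ^ a (Suc j) - z ^ a j)"
    unfolding T_def a_def half_power_three_Suc diff_one_cube_power
    by (simp only: power_add right_diff_distrib mult_1_right)
  also have "\<dots> = z ^ a n - z ^ a 0" by (rule sum_lessThan_telescope)
  also have "\<dots> = - 2" using assms by (simp add: a_def)
  also have "\<dots> = 1" by (simp add: two_eq_minus_1)
  finally have "T = 1" .
  have "(\<Sum>j<n. \<Sum>k<n. (z * (z - 1) ^ 2) ^ ((3 ^ j + 3 ^ k) div 2)) = z * (T * T)"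
    unfolding summand T_def sum_product by (simp add: sum_distrib_left)
  thus ?thesis by (simp add: \<open>T = 1\<close>)
qed

lemma f_map_C0:
  fixes c :: 'a
  assumes "c \<in> C0"
  shows "f_map \<alpha> \<beta> \<gamma> t c = \<alpha> * (c * (c - \<gamma>) ^ 2)"
proof -
  have "c ^ 3 + \<gamma> * c ^ 2 + \<gamma> ^ 2 * c = c * (c - \<gamma>) ^ 2 + 3 * (\<gamma> * c ^ 2)"
    by (simp add: power2_eq_square power3_eq_cube algebra_simps)
  thus ?thesis using assms by (simp add: f_map_def three_eq_0)
qed

end

theorem theorem9:
  fixes n t m s :: nat and r :: int
    and \<alpha> \<beta> \<gamma> :: "'a::{finite,field}"
  assumes "n \<ge> 1" and "t \<ge> 1"
    and "CARD('a) = 3 ^ n"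
    and "\<alpha> \<noteq> 0" and "\<beta> \<noteq> 0" and "\<gamma> \<noteq> 0"
    and "bij (f_map \<alpha> \<beta> \<gamma> t)"
    and "m \<in> {0, 1}" and "quad_char \<alpha> = (-1) ^ m"
    and "1 \<le> s" and "s < (3 ^ n - 1) div 2"
    and "int s * int t + r * int ((3 ^ n - 1) div 2) = 1"
  shows "inverse_poly_of (f_inv_poly n \<alpha> \<beta> \<gamma> m r s) (f_map \<alpha> \<beta> \<gamma> t)"
proof -
  define N :: nat where "N = (3 ^ n - 1) div 2"
  define f where "f = f_map \<alpha> \<beta> \<gamma> t"
  define \<epsilon> :: 'a where "\<epsilon> = (- 1) ^ m"
  have "odd (3 ^ n :: nat)" by simp
  hence q: "CARD('a) = 2 * N + 1"
    unfolding N_def assms(3)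
    by (metis oddE add_diff_cancel_right' nonzero_mult_div_cancel_left zero_neq_numeral)
  have "N > 0" using assms(10,11) by (simp add: N_def)
  note C0_iff = C0_iff_power_half_card[OF q \<open>N > 0\<close>]
  note C1_pow = C1_power_half_card[OF _ q \<open>N > 0\<close>]
  have two: "(2 :: 'a) = - 1" by (rule two_eq_minus_1[OF assms(3)])
  have "\<epsilon> * \<epsilon> = 1" by (simp add: \<epsilon>_def flip: power_add)
  have \<alpha>_pow: "\<alpha> ^ N = \<epsilon>"
    using quad_char_power_half_card[OF q \<open>N > 0\<close>, of \<alpha>] assms(9) by (simp add: \<epsilon>_def)
  have f0: "f 0 = 0" by (simp add: f_def f_map_def C0_def C1_def)
  have fC0: "f c = \<alpha> * (c * (c - \<gamma>) ^ 2)" if "c \<in> C0" for c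
    unfolding f_def using f_map_C0[OF assms(3) that] .
  have fC1: "f c = \<beta> * c ^ t" if "c \<in> C1" for c
    using that by (simp add: f_def f_map_def C1_def)
  have inj: "f x = f y \<Longrightarrow> x = y" for x y
    using assms(7) by (auto simp: f_def bij_def dest: injD)
  have "\<gamma> \<notin> C0"
  proof
    assume "\<gamma> \<in> C0"
    hence "f \<gamma> = f 0" by (simp add: fC0 f0)
    with inj \<open>\<gamma> \<noteq> 0\<close> show False by blast
  qed
  hence \<gamma>_pow: "\<gamma> ^ N = - 1" using \<open>\<gamma> \<noteq> 0\<close> C1_pow[of \<gamma>] by (simp add: C1_def)
  have fC0_pow: "f c ^ N = \<epsilon>" if "c \<in> C0" for c
  proof -
    have "c - \<gamma> \<noteq> 0" using that \<open>\<gamma> \<notin> C0\<close> by auto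
    hence "(c - \<gamma>) ^ 2 \<in> C0" by (auto simp: C0_def)
    thus ?thesis using that by (simp add: fC0 power_mult_distrib \<alpha>_pow C0_iff)
  qed
  have fC1_pow: "f c ^ N = - \<epsilon>" if "c \<in> C1" for c
  proof -
    \<comment> \<open>The right-hand side does not depend on \<open>c\<close>, so a single point of
      \<open>C1\<close> determines the character of \<open>f\<close> on all of it.\<close>
    have C1_const: "f c ^ N = \<beta> ^ N * (- 1) ^ t" if "c \<in> C1" for c
      using C1_pow[OF that] that
      by (simp add: fC1 power_mult_distrib flip: power_mult)
        (simp add: mult.commute[of t N] power_mult)
    \<comment> \<open>This value has character \<open>- \<epsilon>\<close>, which \<open>f\<close>
      takes neither on \<open>C0\<close> nor at 0.\<close>
    obtain b where b: "f b = \<alpha> * \<gamma>"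
      using assms(7) by (metis bij_pointE f_def)
    have b_pow: "f b ^ N = - \<epsilon>"
      by (simp add: b power_mult_distrib \<alpha>_pow \<gamma>_pow)
    have "\<epsilon> \<noteq> 0" by (simp add: \<epsilon>_def)
    have "b \<noteq> 0" using b f0 \<open>\<alpha> \<noteq> 0\<close> \<open>\<gamma> \<noteq> 0\<close> by auto
    moreover have "b \<notin> C0"
    proof
      assume "b \<in> C0"
      hence "\<epsilon> = - \<epsilon>" using fC0_pow b_pow by simp
      hence "2 * \<epsilon> = 0" by (simp only: mult_2 eq_neg_iff_add_eq_0)
      moreover have "(2 :: 'a) \<noteq> 0" by (simp only: two) simp
      ultimately show False using \<open>\<epsilon> \<noteq> 0\<close> by simp
    qed
    ultimately have "b \<in> C1" by (simp add: C1_def)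
    thus ?thesis using C1_const that b_pow by simp
  qed
  have eval: "poly (f_inv_poly n \<alpha> \<beta> \<gamma> m r s) y
      = - poly (u_poly n \<alpha> \<gamma>) y * (1 + \<epsilon> * y ^ N)
        - poly (v_poly \<beta> r s) y * (1 - \<epsilon> * y ^ N)" for y
    by (simp add: f_inv_poly_def \<epsilon>_def N_def)
  have u_eval: "poly (u_poly n \<alpha> \<gamma>) y
      = \<gamma> * (\<Sum>j<n. \<Sum>k<n. (y / (\<alpha> * \<gamma> ^ 3)) ^ ((3 ^ j + 3 ^ k) div 2))" for y
    by (simp add: u_poly_def poly_sum sum_distrib_left field_simps)
  have v_eval: "poly (v_poly \<beta> r s) y = (- 1) powi r * (y / \<beta>) ^ s" for y
    by (simp add: v_poly_def field_simps)
  have "poly (f_inv_poly n \<alpha> \<beta> \<gamma> m r s) (f c) = c" for c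
  proof -
    consider "c = 0" | "c \<in> C0" | "c \<in> C1" by (auto simp: C1_def)
    thus ?thesis
    proof cases
      case 1
      have "poly (u_poly n \<alpha> \<gamma>) 0 = 0"
        by (simp add: u_eval half_sum_powers_three)
      moreover have "poly (v_poly \<beta> r s) 0 = 0"
        using \<open>1 \<le> s\<close> by (simp add: v_eval)
      ultimately show ?thesis by (simp add: 1 f0 eval)
    next
      case 2
      \<comment> \<open>Scaling by \<open>\<gamma>\<close> moves the double root of the cubic to 1
        and turns the square \<open>c\<close> into a nonsquare \<open>z\<close>.\<close>
      define z where "z = c / \<gamma>"
      have c: "c = z * \<gamma>" using \<open>\<gamma> \<noteq> 0\<close> by (simp add: z_def)
      have "f c = z * (z - 1) ^ 2 * (\<alpha> * \<gamma> ^ 3)"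
        unfolding fC0[OF 2] unfolding c by (simp add: power2_eq_square power3_eq_cube algebra_simps)
      hence "f c / (\<alpha> * \<gamma> ^ 3) = z * (z - 1) ^ 2"
        using \<open>\<alpha> \<noteq> 0\<close> \<open>\<gamma> \<noteq> 0\<close> by simp
      moreover have "z ^ N = - 1"
        using 2 by (simp add: z_def power_divide \<gamma>_pow C0_iff)
      ultimately have "poly (u_poly n \<alpha> \<gamma>) (f c) = c"
        using double_sum_half_powers[OF assms(3), of z] by (simp add: u_eval c N_def)
      \<comment> \<open>The factor of \<open>v\<close> is 1 - 1 = 0, and that of \<open>u\<close> is
        2 = -1, which cancels the leading minus sign.\<close>
      thus ?thesis by (simp add: eval fC0_pow[OF 2] \<open>\<epsilon> * \<epsilon> = 1\<close> two)
    next
      case 3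
      hence "c \<noteq> 0" by (simp add: C1_def)
      \<comment> \<open>Integer powers are needed because \<open>r\<close> may be negative;
        \<open>c ^ N = - 1\<close> then yields the sign in \<open>v_poly\<close>.\<close>
      have "c = c powi (int s * int t + r * int N)" using assms(12) by (simp add: N_def)
      also have "\<dots> = c powi (int t * int s) * c powi (int N * r)"
        using \<open>c \<noteq> 0\<close> by (simp add: power_int_add mult.commute)
      also have "\<dots> = (c ^ t) ^ s * (- 1) powi r"
        by (simp only: power_int_mult power_int_of_nat C1_pow[OF 3])
      finally have "poly (v_poly \<beta> r s) (f c) = c"
        using \<open>\<beta> \<noteq> 0\<close> by (simp add: v_eval fC1[OF 3] mult.commute)
      thus ?thesis by (simp add: eval fC1_pow[OF 3] \<open>\<epsilon> * \<epsilon> = 1\<close> two)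
    qed
  qed
  thus ?thesis by (simp add: inverse_poly_of_def f_def)
qed

end
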